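(* Let $\varepsilon>0$, let $c:\mathbb{R}^n\times\mathbb{R}^n\to\mathbb{R}$, let $\mathbf{y}=(y_1,\dots,y_M)\in(\mathbb{R}^n)^M$ be fixed, let $p\in\Delta^M$, and let $q\in\Delta^N$ be independent of $\mathbf{z}$ (e.g. uniform). Let $(\mathbf{z}^{(k)},\Gamma^{(k)})_{k\ge 0}$ be iterates of Sinkhorn Coordinate Descent, i.e. $\mathbf{z}^{(0)}\in(\mathbb{R}^n)^N$, $\Gamma^{(0)}\in\mathbf{\Gamma}(q,p)$, and for all $k\ge0$ $$\mathbf{z}^{(k+1)}\in\operatorname*{argmin}_{\mathbf{z}\in(\mathbb{R}^n)^N}\mathcal{L}^c_\varepsilon(\mathbf{z},\Gamma^{(k)};\mathbf{y}),\qquad \Gamma^{(k+1)}\in\operatorname*{argmin}_{\Gamma\in\mathbf{\Gamma}(q,p)}\mathcal{L}^c_\varepsilon(\mathbf{z}^{(k+1)},\Gamma;\mathbf{y}).$$ Then the sequence of objective values $\{\mathcal{L}^c_\varepsilon(\mathbf{z}^{(k)},\Gamma^{(k)};\mathbf{y})\}_{k\ge0}$ is non-increasing.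
   Context: $\Delta^N$ denotes the set of probability vectors of length $N$. The set of couplings is $\mathbf{\Gamma}(q,p)=\{\Gamma\in\mathbb{R}_+^{N\times M}:\Gamma 1_M=q,\ \Gamma^{\mathsf T}1_N=p\}$. For $\mathbf{z}=(z_1,\dots,z_N)\in(\mathbb{R}^n)^N$ and $\Gamma\in\mathbf{\Gamma}(q,p)$, $$\mathcal{L}^c_\varepsilon(\mathbf{z},\Gamma;\mathbf{y})=\sum_{i=1}^N\sum_{j=1}^M c(z_i,y_j)\,\Gamma_{ij}-\varepsilon H(\Gamma),\qquad H(\Gamma)=-\sum_{i,j}\Gamma_{ij}(\log\Gamma_{ij}-1),\quad 0\log0=0.$$ *)

theory Defs
  imports "HOL-Analysis.Analysis"
begin

definition prob_vectors :: "(real ^ 'm) set" where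
  "prob_vectors = {p. (\<forall>j. 0 \<le> p $ j) \<and> (\<Sum>j\<in>UNIV. p $ j) = 1}"

(* The vector 1 of the library has all components equal to 1. *)
definition couplings :: "real ^ 'N \<Rightarrow> real ^ 'M \<Rightarrow> (real ^ 'M ^ 'N) set" where
  "couplings q p =
     {\<Gamma>. (\<forall>i j. 0 \<le> \<Gamma> $ i $ j) \<and> \<Gamma> *v 1 = q \<and> transpose \<Gamma> *v 1 = p}"

(* The convention 0 log 0 = 0 holds because a summand with \<Gamma> $ i $ j = 0
   has the factor 0 and ln is total. *)
definition entropy :: "real ^ 'M ^ 'N \<Rightarrow> real" where
  "entropy \<Gamma> = - (\<Sum>i\<in>UNIV. \<Sum>j\<in>UNIV. \<Gamma> $ i $ j * (ln (\<Gamma> $ i $ j) - 1))"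

definition transport_objective ::
  "(real ^ 'n \<Rightarrow> real ^ 'n \<Rightarrow> real) \<Rightarrow> real \<Rightarrow> (real ^ 'n) ^ 'M \<Rightarrow>
   (real ^ 'n) ^ 'N \<Rightarrow> real ^ 'M ^ 'N \<Rightarrow> real" where
  "transport_objective c \<epsilon> y z \<Gamma> =
     (\<Sum>i\<in>UNIV. \<Sum>j\<in>UNIV. c (z $ i) (y $ j) * \<Gamma> $ i $ j) - \<epsilon> * entropy \<Gamma>"

(* The minimisers need neither exist nor be unique: each iterate is assumed to
   be some minimiser. *)
definition sinkhorn_coordinate_descent ::
  "(real ^ 'n \<Rightarrow> real ^ 'n \<Rightarrow> real) \<Rightarrow> real \<Rightarrow> (real ^ 'n) ^ 'M \<Rightarrow> real ^ 'N \<Rightarrow> real ^ 'M \<Rightarrow>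
   (nat \<Rightarrow> (real ^ 'n) ^ 'N) \<Rightarrow> (nat \<Rightarrow> real ^ 'M ^ 'N) \<Rightarrow> bool" where
  "sinkhorn_coordinate_descent c \<epsilon> y q p z \<Gamma> \<longleftrightarrow>
     \<Gamma> 0 \<in> couplings q p \<and>
     (\<forall>k. is_arg_min (\<lambda>w. transport_objective c \<epsilon> y w (\<Gamma> k)) (\<lambda>_. True) (z (Suc k)) \<and>
          is_arg_min (\<lambda>G. transport_objective c \<epsilon> y (z (Suc k)) G)
            (\<lambda>G. G \<in> couplings q p) (\<Gamma> (Suc k)))"

end

theory Submission
  imports Defs
begin

text \<open>Each iteration consists of two partial minimisations, and neither can raise the
  objective as long as the old value of the updated block is an admissible competitor. The points
  are unconstrained; for the plans, the constraint set \<open>couplings q p\<close> is the same at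
  every step, as \<open>q\<close> and \<open>p\<close> do not depend on \<open>z\<close>. The two
  inequalities meet at the mixed pair \<open>z (Suc k)\<close>, \<open>\<Gamma> k\<close>.\<close>

theorem proposition4:
  fixes \<epsilon> :: real
    and c :: "real ^ 'n \<Rightarrow> real ^ 'n \<Rightarrow> real"
    and y :: "(real ^ 'n) ^ 'M"
    and p :: "real ^ 'M" and q :: "real ^ 'N"
    and z :: "nat \<Rightarrow> (real ^ 'n) ^ 'N"
    and \<Gamma> :: "nat \<Rightarrow> real ^ 'M ^ 'N"
  assumes "\<epsilon> > 0"
    and "p \<in> prob_vectors"
    and "q \<in> prob_vectors"
    and "sinkhorn_coordinate_descent c \<epsilon> y q p z \<Gamma>"
  shows "decseq (\<lambda>k. transport_objective c \<epsilon> y (z k) (\<Gamma> k))"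
proof (rule decseq_SucI)
  fix k
  have step:
    "is_arg_min (\<lambda>w. transport_objective c \<epsilon> y w (\<Gamma> i)) (\<lambda>_. True) (z (Suc i))"
    "is_arg_min (\<lambda>G. transport_objective c \<epsilon> y (z (Suc i)) G)
       (\<lambda>G. G \<in> couplings q p) (\<Gamma> (Suc i))" for i
    using assms(4) by (auto simp: sinkhorn_coordinate_descent_def)
  \<comment> \<open>Optimality of \<open>\<Gamma> (Suc k)\<close> compares it with couplings only.
    The initial plan is one by assumption, every later plan because it is a constrained
    minimiser.\<close>
  have feasible: "\<Gamma> k \<in> couplings q p"
  proof (cases k)
    case 0
    then show ?thesis using assms(4) by (simp add: sinkhorn_coordinate_descent_def)
  next
    case (Suc i)
    then show ?thesis using step(2)[of i] by (simp add: is_arg_min_def)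
  qed
  \<comment> \<open>\<open>is_arg_min\<close> only says that no competitor is strictly smaller;
    since the reals are linearly ordered, this gives \<le> against every competitor.\<close>
  have "transport_objective c \<epsilon> y (z (Suc k)) (\<Gamma> (Suc k))
      \<le> transport_objective c \<epsilon> y (z (Suc k)) (\<Gamma> k)"
    using step(2)[of k] feasible by (simp add: is_arg_min_linorder)
  also have "\<dots> \<le> transport_objective c \<epsilon> y (z k) (\<Gamma> k)"
    using step(1)[of k] by (simp add: is_arg_min_linorder)
  finally show "transport_objective c \<epsilon> y (z (Suc k)) (\<Gamma> (Suc k))
      \<le> transport_objective c \<epsilon> y (z k) (\<Gamma> k)" .
qed

end
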